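(* Let $m,n$ be positive integers, $K$ a field, $G$ the $m\times n$ rectangular graph, and $c=\gcd(m+1,n+1)-1$. Let $v\in\ker BW_{m,n}$ (resp. $v\in\ker\mathit{WB}_{m,n}$), regarded as a function on $G$ vanishing on the white (resp. black) points. Then: (i) $v$ vanishes identically on the grid $\mathcal{G}$; (ii) for every fundamental square $S$, the restriction of $v$ to $S$ lies in the kernel of the black-to-white (resp. white-to-black) adjacency map of the graph $S$ (with colors inherited from $G$), i.e. for every white (resp. black) point $p\in S$ the sum of $v$ over the neighbors of $p$ lying in $S$ is $0$; (iii) if $S_1,S_2$ are adjacent fundamental squares separated by a grid column $x=x_0$ (so that $S_2$ is the image of $S_1$ under $(x,y)\mapsto(2x_0-x,y)$), then $v(2x_0-x,y)=-v(x,y)$ for all $(x,y)\in S_1$; similarly, if they are separated by a grid row $y=y_0$, then $v(x,2y_0-y)=-v(x,y)$ for all $(x,y)\in S_1$; (iv) for the $c\times c$ square graph $G_{c,c}$, $2\dim\ker BW_{c,c}=c+(c\bmod 2)$ and $2\dim\ker\mathit{WB}_{c,c}=c-(c\bmod 2)$; (v) $\dim\ker BW_{m,n}=\dim\ker BW_{c,c}$ and $\dim\ker\mathit{WB}_{m,n}=\dim\ker\mathit{WB}_{c,c}$; (vi) $\ker BW_{m,n}$ and $\ker\mathit{WB}_{m,n}$ have bases consisting of vectors whose coordinates take only the values $0,1,-1$. In particular, the dimensions of $\ker BW_{m,n}$ and $\ker\mathit{WB}_{m,n}$ do not depend on the field $K$.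
   Context: For positive integers $p,q$, the $p\times q$ rectangular graph is $G_{p,q}=\{(x,y)\in\mathbb{Z}^2:0\le x\le p-1,\ 0\le y\le q-1\}$ (two points adjacent iff they differ by exactly $1$ in exactly one coordinate); $G=G_{m,n}$, and $G_{0,0}$ is the empty graph (all its kernels are $0$). A point $(x,y)$ is black if $x+y$ is even, white otherwise. Over $K$, $BW_{p,q}$ maps a function $v$ on the black points of $G_{p,q}$ to the function on white points $w\mapsto\sum_{b\text{ black},\,b\sim w}v(b)$; $\mathit{WB}_{p,q}$ is defined analogously from white to black points. The grid $\mathcal{G}$ of $G$ is the set of points of $G$ lying on some line $x=k(c+1)-1$ or $y=k(c+1)-1$ with $k\in\mathbb{Z}$. The fundamental squares are the sets $\{(x,y): k(c+1)\le x\le k(c+1)+c-1,\ l(c+1)\le y\le l(c+1)+c-1\}$ for integers $0\le k<(m+1)/(c+1)$, $0\le l<(n+1)/(c+1)$; these $c\times c$ squares are the pieces into which $G\setminus\mathcal{G}$ splits. *)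

theory Defs
  imports Complex_Main "HOL-Library.Function_Algebras"
begin

definition fun_scale :: "'k::field \<Rightarrow> ('p \<Rightarrow> 'k) \<Rightarrow> 'p \<Rightarrow> 'k" where
  "fun_scale a f = (\<lambda>p. a * f p)"

global_interpretation fun_space: vector_space "fun_scale :: 'k::field \<Rightarrow> ('p \<Rightarrow> 'k) \<Rightarrow> 'p \<Rightarrow> 'k"
  by unfold_locales (auto simp: fun_scale_def fun_eq_iff algebra_simps)

type_synonym point = "int \<times> int"

definition rect_graph :: "nat \<Rightarrow> nat \<Rightarrow> point set" where
  "rect_graph p q = {(x, y). 0 \<le> x \<and> x \<le> int p - 1 \<and> 0 \<le> y \<and> y \<le> int q - 1}"

definition adjacent :: "point \<Rightarrow> point \<Rightarrow> bool" where
  "adjacent a b \<longleftrightarrow>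
     (\<bar>fst a - fst b\<bar> = 1 \<and> snd a = snd b) \<or> (fst a = fst b \<and> \<bar>snd a - snd b\<bar> = 1)"

definition black_points :: "point set \<Rightarrow> point set" where
  "black_points S = {(x, y) \<in> S. even (x + y)}"

definition white_points :: "point set \<Rightarrow> point set" where
  "white_points S = {(x, y) \<in> S. odd (x + y)}"

text \<open>
  The vector space of functions on a set of points \<open>A\<close> is represented by the functions on the whole
  plane that vanish outside \<open>A\<close>.
\<close>

definition functions_on :: "point set \<Rightarrow> (point \<Rightarrow> 'k::field) set" where
  "functions_on A = {v. \<forall>p. p \<notin> A \<longrightarrow> v p = 0}"

definition restrict_to :: "point set \<Rightarrow> (point \<Rightarrow> 'k::field) \<Rightarrow> point \<Rightarrow> 'k" where
  "restrict_to S v = (\<lambda>p. if p \<in> S then v p else 0)"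

definition adjacency_map :: "point set \<Rightarrow> point set \<Rightarrow> (point \<Rightarrow> 'k::field) \<Rightarrow> point \<Rightarrow> 'k" where
  "adjacency_map A B v = restrict_to B (\<lambda>w. \<Sum>b | b \<in> A \<and> adjacent b w. v b)"

definition BW :: "point set \<Rightarrow> (point \<Rightarrow> 'k::field) \<Rightarrow> point \<Rightarrow> 'k" where
  "BW S = adjacency_map (black_points S) (white_points S)"

definition WB :: "point set \<Rightarrow> (point \<Rightarrow> 'k::field) \<Rightarrow> point \<Rightarrow> 'k" where
  "WB S = adjacency_map (white_points S) (black_points S)"

definition ker_BW :: "point set \<Rightarrow> (point \<Rightarrow> 'k::field) set" where
  "ker_BW S = {v \<in> functions_on (black_points S). BW S v = 0}"

definition ker_WB :: "point set \<Rightarrow> (point \<Rightarrow> 'k::field) set" where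
  "ker_WB S = {v \<in> functions_on (white_points S). WB S v = 0}"

definition is_basis :: "(point \<Rightarrow> 'k::field) set \<Rightarrow> (point \<Rightarrow> 'k) set \<Rightarrow> bool" where
  "is_basis B V \<longleftrightarrow> fun_space.independent B \<and> fun_space.span B = V"

definition grid_lines :: "nat \<Rightarrow> int set" where
  "grid_lines c = {k * (int c + 1) - 1 | k. True}"

definition grid :: "nat \<Rightarrow> nat \<Rightarrow> nat \<Rightarrow> point set" where
  "grid m n c = {(x, y) \<in> rect_graph m n. x \<in> grid_lines c \<or> y \<in> grid_lines c}"

definition square :: "nat \<Rightarrow> int \<Rightarrow> int \<Rightarrow> point set" where
  "square c k l =
     {(x, y). k * (int c + 1) \<le> x \<and> x \<le> k * (int c + 1) + int c - 1 \<and>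
              l * (int c + 1) \<le> y \<and> y \<le> l * (int c + 1) + int c - 1}"

text \<open>
  Indices of the fundamental squares. The squares are indexed rather than treated only as sets
  because for \<open>c = 0\<close> they are all empty.
\<close>

definition square_indices :: "nat \<Rightarrow> nat \<Rightarrow> nat \<Rightarrow> (int \<times> int) set" where
  "square_indices m n c =
     {(k, l). 0 \<le> k \<and> real_of_int k < (real m + 1) / (real c + 1) \<and>
              0 \<le> l \<and> real_of_int l < (real n + 1) / (real c + 1)}"

definition fundamental_squares :: "nat \<Rightarrow> nat \<Rightarrow> nat \<Rightarrow> point set set" where
  "fundamental_squares m n c = {square c k l | k l. (k, l) \<in> square_indices m n c}"

definition separated_by_column ::
    "nat \<Rightarrow> nat \<Rightarrow> nat \<Rightarrow> int \<Rightarrow> point set \<Rightarrow> point set \<Rightarrow> bool" where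
  "separated_by_column m n c x\<^sub>0 S\<^sub>1 S\<^sub>2 \<longleftrightarrow>
     (\<exists>k l. (k, l) \<in> square_indices m n c \<and> (k + 1, l) \<in> square_indices m n c \<and>
        x\<^sub>0 = (k + 1) * (int c + 1) - 1 \<and>
        (S\<^sub>1 = square c k l \<and> S\<^sub>2 = square c (k + 1) l \<or>
         S\<^sub>1 = square c (k + 1) l \<and> S\<^sub>2 = square c k l))"

definition separated_by_row ::
    "nat \<Rightarrow> nat \<Rightarrow> nat \<Rightarrow> int \<Rightarrow> point set \<Rightarrow> point set \<Rightarrow> bool" where
  "separated_by_row m n c y\<^sub>0 S\<^sub>1 S\<^sub>2 \<longleftrightarrow>
     (\<exists>k l. (k, l) \<in> square_indices m n c \<and> (k, l + 1) \<in> square_indices m n c \<and>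
        y\<^sub>0 = (l + 1) * (int c + 1) - 1 \<and>
        (S\<^sub>1 = square c k l \<and> S\<^sub>2 = square c k (l + 1) \<or>
         S\<^sub>1 = square c k (l + 1) \<and> S\<^sub>2 = square c k l))"

end

theory Submission
  imports Defs
begin

text \<open>
  Put \<open>M = m + 1\<close>, \<open>N = n + 1\<close>, \<open>g = gcd M N\<close>. Up to the sign \<open>(-1)\<^sup>y\<close> the kernel equation is the
  discrete wave equation, so by d'Alembert's formula a kernel vector has the form
  \<open>v(x, y) = (-1)\<^sup>y (F(x - y) - F(x + y + 2))\<close>. Vanishing on the lines \<open>y = -1\<close>, \<open>x = -1\<close>, \<open>x = m\<close>,
  \<open>y = n\<close> is automatic in the first case and otherwise says that \<open>F\<close> is even, \<open>2M\<close>-periodic and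
  \<open>2N\<close>-periodic; hence \<open>F\<close> is even and \<open>2g\<close>-periodic, and conversely each such \<open>F\<close> gives a kernel
  vector. The vanishing and reflection properties are symmetries of \<open>F\<close>. Finally \<open>v\<close> is determined
  by \<open>v(s, 0) = F(s) - F(s + 2)\<close> for \<open>s < g - 1\<close>, and the periodic indicator functions of the
  points of \<open>[-s, s]\<close> congruent to \<open>s\<close> modulo 2 give the basis dual to these coordinates.
\<close>

section \<open>The kernels through neighbour sums\<close>

text \<open>All four lattice neighbours count here, also those outside the graph. For functions
  vanishing outside the graph this changes nothing and removes case distinctions at the
  boundary.\<close>

definition nbsum :: "(point \<Rightarrow> 'k::field) \<Rightarrow> int \<Rightarrow> int \<Rightarrow> 'k" where
  "nbsum v x y = v (x + 1, y) + v (x - 1, y) + v (x, y + 1) + v (x, y - 1)"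

text \<open>The kernel of the full adjacency operator, with both colours together.
  \<open>ker_BW\<close> and \<open>ker_WB\<close> are its parts supported on one colour, so most
  arguments are carried out once, here.\<close>

definition adj_kernel :: "point set \<Rightarrow> (point \<Rightarrow> 'k::field) set" where
  "adj_kernel S = {v. (\<forall>p. p \<notin> S \<longrightarrow> v p = 0) \<and> (\<forall>x y. (x, y) \<in> S \<longrightarrow> nbsum v x y = 0)}"

text \<open>The vanishing hypothesis is local to the neighbours of \<open>(x, y)\<close>, so that
  \<open>A\<close> may also be a fundamental square, outside which \<open>v\<close> need not
  vanish.\<close>

lemma sum_adjacent_eq_nbsum:
  assumes "\<And>b. adjacent b (x, y) \<Longrightarrow> b \<notin> A \<Longrightarrow> v b = 0"
  shows "(\<Sum>b | b \<in> A \<and> adjacent b (x, y). v b) = nbsum v x y"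
proof -
  have adj: "{b. adjacent b (x, y)} = {(x + 1, y), (x - 1, y), (x, y + 1), (x, y - 1)}"
    by (auto simp: adjacent_def)
  have "(\<Sum>b | b \<in> A \<and> adjacent b (x, y). v b) = (\<Sum>b | adjacent b (x, y). v b)"
    by (rule sum.mono_neutral_left) (use assms adj in auto)
  also have "\<dots> = nbsum v x y"
    unfolding adj nbsum_def by (simp add: add.assoc)
  finally show ?thesis .
qed

lemma ker_BW_eq:
  "(ker_BW S :: (point \<Rightarrow> 'k::field) set) =
     {v \<in> adj_kernel S. \<forall>x y. odd (x + y) \<longrightarrow> v (x, y) = 0}"
proof -
  have *: "BW S v = 0 \<longleftrightarrow> (\<forall>x y. (x, y) \<in> S \<longrightarrow> nbsum v x y = 0)"
    if v: "v \<in> functions_on (black_points S)" for v :: "point \<Rightarrow> 'k"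
  proof -
    have eq: "BW S v (x, y) = (if (x, y) \<in> white_points S then nbsum v x y else 0)" for x y
      using v sum_adjacent_eq_nbsum[of x y "black_points S" v]
      by (auto simp: BW_def adjacency_map_def restrict_to_def functions_on_def)
    \<comment> \<open>At a black point all neighbours are white, so the equations that
      \<open>adj_kernel\<close> adds to \<open>BW S v = 0\<close> hold trivially.\<close>
    have "nbsum v x y = 0" if "even (x + y)" for x y
      using v that unfolding nbsum_def functions_on_def black_points_def by simp
    then show ?thesis
      by (auto simp: fun_eq_iff eq white_points_def)
  qed
  have "v \<in> functions_on (black_points S) \<longleftrightarrow>
      (\<forall>p. p \<notin> S \<longrightarrow> v p = 0) \<and> (\<forall>x y. odd (x + y) \<longrightarrow> v (x, y) = 0)" for v :: "point \<Rightarrow> 'k"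
    by (fastforce simp: functions_on_def black_points_def)
  with * show ?thesis
    unfolding ker_BW_def adj_kernel_def by blast
qed

lemma ker_WB_eq:
  "(ker_WB S :: (point \<Rightarrow> 'k::field) set) =
     {v \<in> adj_kernel S. \<forall>x y. even (x + y) \<longrightarrow> v (x, y) = 0}"
proof -
  have *: "WB S v = 0 \<longleftrightarrow> (\<forall>x y. (x, y) \<in> S \<longrightarrow> nbsum v x y = 0)"
    if v: "v \<in> functions_on (white_points S)" for v :: "point \<Rightarrow> 'k"
  proof -
    have eq: "WB S v (x, y) = (if (x, y) \<in> black_points S then nbsum v x y else 0)" for x y
      using v sum_adjacent_eq_nbsum[of x y "white_points S" v]
      by (auto simp: WB_def adjacency_map_def restrict_to_def functions_on_def)
    have "nbsum v x y = 0" if "odd (x + y)" for x y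
      using v that unfolding nbsum_def functions_on_def white_points_def by simp
    then show ?thesis
      by (auto simp: fun_eq_iff eq black_points_def)
  qed
  have "v \<in> functions_on (white_points S) \<longleftrightarrow>
      (\<forall>p. p \<notin> S \<longrightarrow> v p = 0) \<and> (\<forall>x y. even (x + y) \<longrightarrow> v (x, y) = 0)" for v :: "point \<Rightarrow> 'k"
    by (fastforce simp: functions_on_def white_points_def)
  with * show ?thesis
    unfolding ker_WB_def adj_kernel_def by blast
qed

section \<open>Even periodic functions and d'Alembert's formula\<close>

definition even_periodic :: "int \<Rightarrow> (int \<Rightarrow> 'k) \<Rightarrow> bool" where
  "even_periodic g F \<longleftrightarrow> (\<forall>t. F (- t) = F t) \<and> (\<forall>t. F (t + 2 * g) = F t)"

definition alt_sign :: "int \<Rightarrow> 'k::field" where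
  "alt_sign y = (if even y then 1 else - 1)"

text \<open>The shift by 2 makes the two arguments of \<open>F\<close> coincide on the row
  \<open>y = -1\<close>, so the wave vanishes there for every \<open>F\<close>.\<close>

definition wave :: "(int \<Rightarrow> 'k::field) \<Rightarrow> int \<Rightarrow> int \<Rightarrow> 'k" where
  "wave F x y = alt_sign y * (F (x - y) - F (x + y + 2))"

section \<open>Periods and reflections of functions on the integers\<close>

lemma period_mult:
  fixes F :: "int \<Rightarrow> 'k"
  assumes "\<And>t. F (t + a) = F t"
  shows "F (t + k * a) = F t"
proof (induction k arbitrary: t rule: int_induct[where k = 0])
  case base
  then show ?case by simp
next
  case (step1 i)
  then show ?case using assms[of "t + i * a"] by (simp add: algebra_simps)
next
  case (step2 i)
  then show ?case using assms[of "t + (i - 1) * a"] by (simp add: algebra_simps)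
qed

lemma period_gcd:
  fixes F :: "int \<Rightarrow> 'k"
  assumes a: "\<And>t. F (t + a) = F t" and b: "\<And>t. F (t + b) = F t"
  shows "F (t + gcd a b) = F t"
proof -
  obtain u w where "u * a + w * b = gcd a b"
    using bezout_int by blast
  then have "F (t + gcd a b) = F ((t + u * a) + w * b)"
    by (simp add: algebra_simps)
  also have "\<dots> = F t"
    using period_mult[of F a] period_mult[of F b] a b by simp
  finally show ?thesis .
qed

text \<open>Invariance under the infinite dihedral group generated by negation and translation by
  \<open>2 * g\<close>. The symmetries and zero lines of waves below are instances of it.\<close>

lemma even_periodic_shift:
  assumes "even_periodic g F" and "b = a + 2 * (k * g) \<or> b = - a + 2 * (k * g)"
  shows "F b = F a"
proof -
  have "F (t + k * (2 * g)) = F t" for t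
    using period_mult[of F "2 * g"] assms(1) unfolding even_periodic_def by blast
  moreover have "b = a + k * (2 * g) \<or> b = - a + k * (2 * g)"
    using assms(2) by (simp add: algebra_simps)
  ultimately show ?thesis
    using assms(1) unfolding even_periodic_def by metis
qed

text \<open>Horizontal and vertical steps produce the same values of \<open>F\<close>, and
  \<open>alt_sign\<close> gives them opposite signs.\<close>

lemma nbsum_wave: "nbsum (\<lambda>(x, y). wave F x y) x y = 0"
  by (simp add: nbsum_def wave_def alt_sign_def algebra_simps)

text \<open>Modulo the symmetry t -> 2kg - t, the reflection exchanges the arguments
  \<open>x - y\<close> and \<open>x + y + 2\<close>. For rows, translations by multiples of
  \<open>2 * g\<close> do the same, and the parity of \<open>y\<close> is preserved.\<close>

lemma wave_column_reflect:
  assumes "even_periodic g F"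
  shows "wave F (2 * (k * g - 1) - x) y = - wave F x y"
  using even_periodic_shift[OF assms, of "2 * (k * g - 1) - x - y" "x + y + 2" k]
    even_periodic_shift[OF assms, of "2 * (k * g - 1) - x + y + 2" "x - y" k]
  unfolding wave_def by (simp add: algebra_simps)

lemma wave_row_reflect:
  assumes "even_periodic g F"
  shows "wave F x (2 * (k * g - 1) - y) = - wave F x y"
  using even_periodic_shift[OF assms, of "x - (2 * (k * g - 1) - y)" "x + y + 2" "- k"]
    even_periodic_shift[OF assms, of "x + (2 * (k * g - 1) - y) + 2" "x - y" k]
  unfolding wave_def alt_sign_def by (simp add: algebra_simps)

text \<open>On such a line the two arguments of \<open>F\<close> are equivalent under its
  symmetries. Antisymmetry under reflection would only give 2 * wave = 0, which says nothing in
  characteristic 2.\<close>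

lemma wave_column_eq_0:
  assumes "even_periodic g F" and "x = k * g - 1"
  shows "wave F x y = 0"
  using even_periodic_shift[OF assms(1), of "x + y + 2" "x - y" k] assms(2)
  by (simp add: wave_def)

lemma wave_row_eq_0:
  assumes "even_periodic g F" and "y = k * g - 1"
  shows "wave F x y = 0"
  using even_periodic_shift[OF assms(1), of "x + y + 2" "x - y" k] assms(2)
  by (simp add: wave_def)

text \<open>For \<open>M > 0\<close> this is the distance from \<open>t\<close> to the nearest
  multiple of \<open>2 * M\<close>. Composing with it extends a function on [0, M] to an even
  function of period \<open>2 * M\<close>.\<close>

definition fold_int :: "int \<Rightarrow> int \<Rightarrow> int" where
  "fold_int M t = min (t mod (2 * M)) ((- t) mod (2 * M))"

lemma fold_int_id:
  assumes "0 \<le> t" "t \<le> M"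
  shows "fold_int M t = t"
proof (cases "t = 0")
  case False
  then have "(- t) mod (2 * M) = 2 * M - t" "t mod (2 * M) = t"
    using assms by (simp_all add: zmod_zminus1_eq_if)
  then show ?thesis using assms by (simp add: fold_int_def)
qed (simp add: fold_int_def)

lemma even_periodic_fold: "even_periodic M (\<lambda>t. f (fold_int M t))"
proof -
  have "(- (t + 2 * M)) mod (2 * M) = (- t) mod (2 * M)" for t
    using mod_add_self2[of "- t - 2 * M" "2 * M"] by simp
  then show ?thesis
    by (simp add: even_periodic_def fold_int_def min.commute)
qed

text \<open>Oddness and periodicity carry the zeros on [0, M] to [M, 2M], hence everywhere. This
  spreads equations known only inside the rectangle to all integers.\<close>

lemma odd_periodic_zero:
  fixes G :: "int \<Rightarrow> 'k::field"
  assumes "M > 0" and per: "\<And>t. G (t + 2 * M) = G t" and odd: "\<And>t. G (- t) = - G t"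
    and zero: "\<And>t. 0 \<le> t \<Longrightarrow> t \<le> M \<Longrightarrow> G t = 0"
  shows "G t = 0"
proof -
  have mult: "G (s + k * (2 * M)) = G s" for s k
    by (rule period_mult) (rule per)
  define r where "r = t mod (2 * M)"
  have "t = r + (t div (2 * M)) * (2 * M)"
    unfolding r_def by (rule mod_div_mult_eq[symmetric])
  then have "G t = G r"
    using mult by metis
  moreover have "0 \<le> r" "r < 2 * M"
    using \<open>M > 0\<close> by (simp_all add: r_def)
  moreover have "G r = - G (2 * M - r)"
    using per[of "- r"] odd[of r] by (simp add: algebra_simps)
  ultimately show ?thesis
    using zero[of r] zero[of "2 * M - r"] by (cases "r \<le> M") auto
qed

text \<open>The profile \<open>F\<close> on the nonnegative integers, read off from \<open>F(t) - F(t + 2) = v(t, 0)\<close>.\<close>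

fun profile :: "(point \<Rightarrow> 'k::field) \<Rightarrow> nat \<Rightarrow> 'k" where
  "profile v 0 = 0"
| "profile v (Suc 0) = 0"
| "profile v (Suc (Suc t)) = profile v t - v (int t, 0)"

text \<open>Row 0 fixes \<open>F\<close> on [0, M], and folding extends it so that the side columns
  vanish. The kernel equations propagate the formula row by row, and the zero row
  \<open>y = n\<close> supplies the second period. The range includes the frame of zeros around the
  rectangle.\<close>

lemma kernel_wave:
  fixes v :: "point \<Rightarrow> 'k::field"
  assumes v: "v \<in> adj_kernel (rect_graph m n)"
  obtains F where "even_periodic (int (gcd (m + 1) (n + 1))) F"
    and "\<And>x y. - 1 \<le> x \<Longrightarrow> x \<le> int m \<Longrightarrow> - 1 \<le> y \<Longrightarrow> y \<le> int n \<Longrightarrow> v (x, y) = wave F x y"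
proof -
  define M N where "M = int m + 1" and "N = int n + 1"
  define F where "F t = profile v (nat (fold_int M t))" for t
  have out: "v p = 0" if "p \<notin> rect_graph m n" for p
    using v that unfolding adj_kernel_def by blast
  have epM: "even_periodic M F"
    unfolding F_def by (rule even_periodic_fold)
  then have ev: "F (- t) = F t" and per: "F (t + 2 * M) = F t" for t
    unfolding even_periodic_def by auto
  have F_id: "F t = profile v (nat t)" if "0 \<le> t" "t \<le> M" for t
    using that by (simp add: F_def fold_int_id)
  have left: "wave F (- 1) y = 0" for y
    by (rule wave_column_eq_0[OF epM, of _ 0]) simp
  have right: "wave F (int m) y = 0" for y
    by (rule wave_column_eq_0[OF epM, of _ 1]) (simp add: M_def)
  have bd: "v (x, y) = wave F x y" if "x = - 1 \<or> x = int m" for x y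
    using that left right out by (auto simp: rect_graph_def)
  have row0: "v (x, 0) = wave F x 0" if x: "- 1 \<le> x" "x \<le> int m" for x
  proof (cases "x = - 1 \<or> x = int m")
    case False
    with x have x: "0 \<le> x" "x + 2 \<le> M" by (auto simp: M_def)
    then have "nat (x + 2) = Suc (Suc (nat x))" by simp
    then have "F (x + 2) = F x - v (x, 0)"
      using x by (simp add: F_id)
    then show ?thesis by (simp add: wave_def alt_sign_def)
  qed (rule bd)
  \<comment> \<open>The kernel equation is a three-term recurrence in \<open>y\<close>, so the
    induction carries two consecutive rows, beginning with the frame row \<open>y = -1\<close> and
    row 0.\<close>
  have rows: "int j \<le> int n \<Longrightarrow>
      (\<forall>x. - 1 \<le> x \<and> x \<le> int m \<longrightarrow> v (x, int j - 1) = wave F x (int j - 1) \<and>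
         v (x, int j) = wave F x (int j))" for j
  proof (induction j)
    case 0
    have "v (x, - 1) = wave F x (- 1)" for x
      using out[of "(x, - 1)"] by (simp add: wave_def rect_graph_def add.commute)
    with row0 show ?case by simp
  next
    case (Suc j)
    have IH: "v (x, int j - 1) = wave F x (int j - 1)" "v (x, int j) = wave F x (int j)"
      if "- 1 \<le> x" "x \<le> int m" for x
      using Suc that by auto
    have "v (x, int j + 1) = wave F x (int j + 1)" if x: "- 1 \<le> x" "x \<le> int m" for x
    proof (cases "x = - 1 \<or> x = int m")
      case False
      with x have x: "0 \<le> x" "x \<le> int m - 1" by auto
      then have "(x, int j) \<in> rect_graph m n"
        using Suc.prems by (auto simp: rect_graph_def)
      then have "nbsum v x (int j) = 0"
        using v by (auto simp: adj_kernel_def)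
      then have "nbsum v x (int j) = nbsum (\<lambda>(x, y). wave F x y) x (int j)"
        by (simp add: nbsum_wave)
      then show ?thesis
        using IH(2)[of "x + 1"] IH(2)[of "x - 1"] IH(1)[of x] x
        by (simp add: nbsum_def)
    qed (rule bd)
    with IH(2) show ?case by (simp add: add.commute)
  qed
  have rep: "v (x, y) = wave F x y" if "- 1 \<le> x" "x \<le> int m" "- 1 \<le> y" "y \<le> int n" for x y
  proof (cases "y = - 1")
    case True
    with rows[of 0] that show ?thesis by simp
  next
    case False
    with rows[of "nat y"] that show ?thesis by simp
  qed
  \<comment> \<open>Up to sign this difference is the wave at \<open>(t - 1, n)\<close>, which is
    zero for 0 \<le> t \<le> M. It is odd in \<open>t\<close> because \<open>F\<close> is
    even.\<close>
  have "F (t + N) - F (t - N) = 0" for t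
  proof (rule odd_periodic_zero[where M = M and G = "\<lambda>t. F (t + N) - F (t - N)"])
    show "M > 0" by (simp add: M_def)
    show "F (t + 2 * M + N) - F (t + 2 * M - N) = F (t + N) - F (t - N)" for t
      using per[of "t + N"] per[of "t - N"] by (simp add: algebra_simps)
    show "F (- t + N) - F (- t - N) = - (F (t + N) - F (t - N))" for t
      using ev[of "t - N"] ev[of "- t - N"] by (simp add: algebra_simps)
    show "F (t + N) - F (t - N) = 0" if "0 \<le> t" "t \<le> M" for t
    proof -
      have "v (t - 1, int n) = wave F (t - 1) (int n)"
        using that by (intro rep) (auto simp: M_def)
      moreover have "v (t - 1, int n) = 0"
        by (rule out) (simp add: rect_graph_def)
      ultimately show ?thesis
        by (simp add: wave_def alt_sign_def N_def algebra_simps split: if_splits)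
    qed
  qed
  from this[of "_ + N"] have "F (t + 2 * N) = F t" for t
    by (simp add: algebra_simps)
  then have "F (t + gcd (2 * M) (2 * N)) = F t" for t
    using per period_gcd[of F "2 * M" "2 * N"] by blast
  moreover have "gcd (2 * M) (2 * N) = 2 * int (gcd (m + 1) (n + 1))"
    using gcd_mult_distrib_int[of 2 M N] gcd_int_int_eq[of "m + 1" "n + 1"]
    by (simp add: M_def N_def add.commute)
  ultimately have "even_periodic (int (gcd (m + 1) (n + 1))) F"
    using ev by (simp add: even_periodic_def)
  then show ?thesis using rep by (rule that)
qed

section \<open>The dual basis\<close>

text \<open>For \<open>g > 0\<close> the two residues compare the distance from \<open>t\<close> to
  the nearest multiple of \<open>2 * g\<close> with \<open>s\<close>. The parity condition confines
  the resulting wave to one colour, since \<open>x - y\<close> and \<open>x + y + 2\<close> have the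
  parity of \<open>x + y\<close>.\<close>

definition bump :: "int \<Rightarrow> nat \<Rightarrow> int \<Rightarrow> 'k::field" where
  "bump g s t =
     (if even (t - int s) \<and> (t mod (2 * g) \<le> int s \<or> (- t) mod (2 * g) \<le> int s) then 1 else 0)"

definition kernel_vector :: "nat \<Rightarrow> nat \<Rightarrow> nat \<Rightarrow> point \<Rightarrow> 'k::field" where
  "kernel_vector m n s =
     restrict_to (rect_graph m n) (\<lambda>(x, y). wave (bump (int (gcd (m + 1) (n + 1))) s) x y)"

lemma even_periodic_bump: "even_periodic g (bump g s)"
proof -
  have "(- (t + 2 * g)) mod (2 * g) = (- t) mod (2 * g)" for t
    using mod_add_self2[of "- t - 2 * g" "2 * g"] by simp
  then show ?thesis
    by (auto simp: even_periodic_def bump_def)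
qed

text \<open>For 0 < t \<le> g the residue of \<open>- t\<close> is 2g - t \<ge> g > s, so only the
  residue of \<open>t\<close> itself can satisfy the bound.\<close>

lemma bump_le:
  assumes "0 \<le> t" "t \<le> g" "int s + 2 \<le> g"
  shows "bump g s t = (if even (t - int s) \<and> t \<le> int s then 1 else 0)"
proof (cases "t = 0")
  case False
  then have "(- t) mod (2 * g) = 2 * g - t" "t mod (2 * g) = t"
    using assms by (simp_all add: zmod_zminus1_eq_if)
  with assms show ?thesis by (auto simp: bump_def)
qed (simp add: bump_def)

text \<open>The frame around the rectangle consists of zero lines of the wave, since
  \<open>m + 1\<close> and \<open>n + 1\<close> are multiples of the gcd. Cutting off outside the
  rectangle therefore leaves the neighbour sums at its points unchanged.\<close>

lemma kernel_vector_in_kernel: "kernel_vector m n s \<in> adj_kernel (rect_graph m n)"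
proof -
  define g where "g = int (gcd (m + 1) (n + 1))"
  define w :: "point \<Rightarrow> 'a" where "w = (\<lambda>(x, y). wave (bump g s) x y)"
  obtain a b where ab: "int m + 1 = a * g" "int n + 1 = b * g"
  proof -
    have "g dvd int (m + 1)" "g dvd int (n + 1)"
      unfolding g_def by (simp_all only: int_dvd_int_iff gcd_dvd1 gcd_dvd2)
    then show ?thesis
      using that unfolding dvd_def by (auto simp: algebra_simps)
  qed
  have "kernel_vector m n s (x, y) = w (x, y)"
    if "- 1 \<le> x" "x \<le> int m" "- 1 \<le> y" "y \<le> int n" for x y
  proof (cases "(x, y) \<in> rect_graph m n")
    case False
    then have "x = 0 * g - 1 \<or> x = a * g - 1 \<or> y = 0 * g - 1 \<or> y = b * g - 1"
      using that ab by (auto simp: rect_graph_def)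
    then have "w (x, y) = 0"
      unfolding w_def prod.case
      using wave_column_eq_0[OF even_periodic_bump[of g s], of x _ y]
        wave_row_eq_0[OF even_periodic_bump[of g s], of y _ x] by blast
    with False show ?thesis by (simp add: kernel_vector_def restrict_to_def)
  qed (simp add: kernel_vector_def restrict_to_def w_def g_def)
  then have "nbsum (kernel_vector m n s) x y = nbsum w x y" if "(x, y) \<in> rect_graph m n" for x y
    using that by (simp add: nbsum_def rect_graph_def)
  then show ?thesis
    by (auto simp: adj_kernel_def w_def nbsum_wave) (simp add: kernel_vector_def restrict_to_def)
qed

lemma kernel_vector_row:
  assumes "s < gcd (m + 1) (n + 1) - 1" "t < gcd (m + 1) (n + 1) - 1"
  shows "kernel_vector m n s (int t, 0) = (if t = s then 1 else 0)"
proof -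
  define g where "g = gcd (m + 1) (n + 1)"
  have st: "s < g - 1" "t < g - 1" using assms by (simp_all add: g_def)
  have "g \<le> m + 1" "g \<le> n + 1"
    unfolding g_def by (rule gcd_le1_nat gcd_le2_nat, simp)+
  then have "(int t, 0) \<in> rect_graph m n"
    using st by (auto simp: rect_graph_def)
  then have "kernel_vector m n s (int t, 0) = (bump (int g) s (int t) - bump (int g) s (int t + 2) :: 'a)"
    by (simp add: kernel_vector_def restrict_to_def wave_def alt_sign_def g_def)
  \<comment> \<open>Both \<open>s + 2\<close> and \<open>t + 2\<close> are at most \<open>g\<close>,
    so \<open>bump_le\<close> applies to both terms. Along steps of 2 the indicator drops exactly
    between \<open>s\<close> and \<open>s + 2\<close>.\<close>
  also have "\<dots> = (if t = s then 1 else 0)"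
    using st by (simp add: bump_le) presburger
  finally show ?thesis .
qed

lemma kernel_vector_parity:
  assumes "odd (x + y - int s)"
  shows "kernel_vector m n s (x, y) = 0"
  using assms by (simp add: kernel_vector_def restrict_to_def wave_def bump_def)

lemma kernel_vector_values: "kernel_vector m n s p \<in> {0, 1, - 1}"
  by (simp add: kernel_vector_def restrict_to_def wave_def bump_def alt_sign_def split: prod.split)

text \<open>The row condition makes \<open>F\<close> 2-periodic, and the two arguments of
  \<open>F\<close> in a wave differ by the even number 2(y + 1).\<close>

lemma adj_kernel_determined:
  fixes v :: "point \<Rightarrow> 'k::field"
  assumes v: "v \<in> adj_kernel (rect_graph m n)"
    and row: "\<And>s. s < gcd (m + 1) (n + 1) - 1 \<Longrightarrow> v (int s, 0) = 0"
  shows "v = 0"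
proof -
  define g where "g = int (gcd (m + 1) (n + 1))"
  have gpos: "g > 0" by (simp add: g_def)
  have gm: "g \<le> int m + 1"
    using gcd_le1_nat[of "m + 1" "n + 1"] unfolding g_def by linarith
  obtain F where F: "even_periodic g F"
    and rep: "\<And>x y. - 1 \<le> x \<Longrightarrow> x \<le> int m \<Longrightarrow> - 1 \<le> y \<Longrightarrow> y \<le> int n \<Longrightarrow> v (x, y) = wave F x y"
    using kernel_wave[OF v] unfolding g_def by metis
  have step: "F (t + 1) - F (t - 1) = 0" for t
  proof (rule odd_periodic_zero[where M = g and G = "\<lambda>t. F (t + 1) - F (t - 1)"])
    show "F (t + 2 * g + 1) - F (t + 2 * g - 1) = F (t + 1) - F (t - 1)" for t
      using even_periodic_shift[OF F, of "t + 2 * g + 1" "t + 1" 1]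
        even_periodic_shift[OF F, of "t + 2 * g - 1" "t - 1" 1] by simp
    show "F (- t + 1) - F (- t - 1) = - (F (t + 1) - F (t - 1))" for t
      using even_periodic_shift[OF F, of "- t + 1" "t - 1" 0]
        even_periodic_shift[OF F, of "- t - 1" "t + 1" 0] by simp
    show "F (t + 1) - F (t - 1) = 0" if t: "0 \<le> t" "t \<le> g" for t
    proof -
      \<comment> \<open>The two ends follow from the reflections of \<open>F\<close> about 0 and
        \<open>g\<close>; strictly between them the difference is, up to sign, the value of
        \<open>v\<close> at \<open>(t - 1, 0)\<close>.\<close>
      consider "t = 0" | "t = g" | "0 < t" "t < g" using t by linarith
      then show ?thesis
      proof cases
        case 1
        then show ?thesis using even_periodic_shift[OF F, of 1 "- 1" 0] by simp
      next
        case 2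
        then show ?thesis using even_periodic_shift[OF F, of "t + 1" "t - 1" 1] by simp
      next
        case 3
        then have "v (int (nat (t - 1)), 0) = 0"
          by (intro row) (auto simp: g_def)
        moreover have "v (t - 1, 0) = wave F (t - 1) 0"
          using 3 gm by (intro rep) auto
        ultimately show ?thesis
          using 3 by (simp add: wave_def alt_sign_def add.commute)
      qed
    qed
  qed (rule gpos)
  have "F (t + 2) = F t" for t
    using step[of "t + 1"] by (simp add: add.commute)
  then have per: "F (t + k * 2) = F t" for t k
    by (rule period_mult)
  have "wave F x y = 0" for x y
    using per[of "x - y" "y + 1"] by (simp add: wave_def algebra_simps)
  then have "v (x, y) = 0" for x y
    using rep[of x y] v by (cases "(x, y) \<in> rect_graph m n") (auto simp: rect_graph_def adj_kernel_def)
  then show ?thesis by (auto simp: fun_eq_iff)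
qed

section \<open>Bases from dual families of evaluation points\<close>

lemma sum_fun_apply: "(\<Sum>i\<in>I. f i) p = (\<Sum>i\<in>I. f i p)"
  by (induction I rule: infinite_finite_induct) auto

text \<open>Evaluation at the points \<open>q j\<close> reads off coefficients, which gives
  independence. A vector minus its interpolant has only zero coordinates, hence is zero, which gives
  spanning.\<close>

lemma dual_family_basis:
  fixes b :: "'i \<Rightarrow> point \<Rightarrow> 'k::field"
  assumes fin: "finite I" and sub: "fun_space.subspace V" and bV: "\<And>i. i \<in> I \<Longrightarrow> b i \<in> V"
    and dual: "\<And>i j. i \<in> I \<Longrightarrow> j \<in> I \<Longrightarrow> b i (q j) = (if j = i then 1 else 0)"
    and determined: "\<And>v. v \<in> V \<Longrightarrow> (\<And>i. i \<in> I \<Longrightarrow> v (q i) = 0) \<Longrightarrow> v = 0"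
  shows "is_basis (b ` I) V" and "fun_space.dim V = card I"
proof -
  have inj: "inj_on b I"
  proof (rule inj_onI)
    fix i j assume "i \<in> I" "j \<in> I" "b i = b j"
    then show "i = j"
      using dual[of i i] dual[of j i] by (simp split: if_splits)
  qed
  have coord: "(\<Sum>i\<in>I. fun_scale (a i) (b i)) (q j) = a j" if "j \<in> I" for a j
  proof -
    have "(\<Sum>i\<in>I. fun_scale (a i) (b i)) (q j) = (\<Sum>i\<in>I. if j = i then a i else 0)"
      unfolding sum_fun_apply fun_scale_def using that dual by (intro sum.cong) auto
    then show ?thesis using fin that by simp
  qed
  have indep: "fun_space.independent (b ` I)"
  proof (rule fun_space.independent_if_scalars_zero)
    fix a x assume "(\<Sum>x\<in>b ` I. fun_scale (a x) x) = 0" and x: "x \<in> b ` I"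
    then have "(\<Sum>i\<in>I. fun_scale (a (b i)) (b i)) = 0"
      using inj by (simp add: sum.reindex)
    then show "a x = 0"
      using x coord[of _ "\<lambda>i. a (b i)"] by auto
  qed (simp add: fin)
  have "V \<subseteq> fun_space.span (b ` I)"
  proof
    fix v assume v: "v \<in> V"
    define w where "w = (\<Sum>i\<in>I. fun_scale (v (q i)) (b i))"
    have "w \<in> V"
      unfolding w_def using bV
      by (intro fun_space.subspace_sum[OF sub] fun_space.subspace_scale[OF sub])
    then have "v - w \<in> V"
      by (rule fun_space.subspace_diff[OF sub v])
    moreover have "(v - w) (q i) = 0" if "i \<in> I" for i
      using coord[OF that] by (simp add: w_def)
    ultimately have "v = w"
      using determined[of "v - w"] by simp
    also have "w \<in> fun_space.span (b ` I)"
      unfolding w_def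
      by (intro fun_space.span_sum fun_space.span_scale fun_space.span_base) auto
    finally show "v \<in> fun_space.span (b ` I)" .
  qed
  moreover have "b ` I \<subseteq> V" using bV by auto
  ultimately show "is_basis (b ` I) V" "fun_space.dim V = card I"
    using indep sub inj fun_space.basis_card_eq_dim[of "b ` I" V]
    by (simp_all add: is_basis_def fun_space.span_subspace card_image)
qed

lemma subspace_adj_kernel:
  "fun_space.subspace {v \<in> adj_kernel S. \<forall>x y. P x y \<longrightarrow> v (x, y) = (0 :: 'k::field)}"
proof -
  have "nbsum (v + w) x y = nbsum v x y + nbsum w x y" for v w :: "point \<Rightarrow> 'k" and x y
    by (simp add: nbsum_def algebra_simps)
  moreover have "nbsum (fun_scale a v) x y = a * nbsum v x y" for a and v :: "point \<Rightarrow> 'k" and x y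
    by (simp add: nbsum_def fun_scale_def algebra_simps)
  moreover have "nbsum (0 :: point \<Rightarrow> 'k) x y = 0" for x y
    by (simp add: nbsum_def)
  moreover have "fun_scale a v p = a * v p" for a and v :: "point \<Rightarrow> 'k" and p
    by (simp add: fun_scale_def)
  ultimately show ?thesis
    unfolding fun_space.subspace_def adj_kernel_def by simp
qed

text \<open>The vectors with even \<open>s\<close> live on black points. The coordinates at
  \<open>(s, 0)\<close> with odd \<open>s\<close> belong to white points and vanish, so the even
  ones determine the vector. \<open>ker_WB_basis\<close> exchanges the parities.\<close>

lemma ker_BW_basis:
  fixes m n :: nat
  defines "I \<equiv> {s. s < gcd (m + 1) (n + 1) - 1 \<and> even s}"
  shows "is_basis (kernel_vector m n ` I) (ker_BW (rect_graph m n) :: (point \<Rightarrow> 'k::field) set)"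
    and "fun_space.dim (ker_BW (rect_graph m n) :: (point \<Rightarrow> 'k) set) = card I"
proof -
  let ?V = "ker_BW (rect_graph m n) :: (point \<Rightarrow> 'k) set"
  have a: "finite I" by (simp add: I_def)
  have b: "fun_space.subspace ?V"
    unfolding ker_BW_eq by (rule subspace_adj_kernel)
  have c: "kernel_vector m n s \<in> ?V" if "s \<in> I" for s
    using that by (auto simp: ker_BW_eq I_def kernel_vector_in_kernel kernel_vector_parity)
  have d: "kernel_vector m n s (int t, 0) = (if t = s then 1 else 0 :: 'k)"
    if "s \<in> I" "t \<in> I" for s t
    using that by (intro kernel_vector_row) (auto simp: I_def)
  have e: "v = 0" if v: "v \<in> ?V" and row: "\<And>s. s \<in> I \<Longrightarrow> v (int s, 0) = 0" for v
  proof (rule adj_kernel_determined)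
    show "v (int s, 0) = 0" if "s < gcd (m + 1) (n + 1) - 1" for s
      using v row[of s] that by (cases "even s") (auto simp: I_def ker_BW_eq)
  qed (use v in \<open>simp add: ker_BW_eq\<close>)
  show "is_basis (kernel_vector m n ` I) ?V" "fun_space.dim ?V = card I"
    by (rule dual_family_basis[where q = "\<lambda>s. (int s, 0)"]; fact a b c d e)+
qed

lemma ker_WB_basis:
  fixes m n :: nat
  defines "I \<equiv> {s. s < gcd (m + 1) (n + 1) - 1 \<and> odd s}"
  shows "is_basis (kernel_vector m n ` I) (ker_WB (rect_graph m n) :: (point \<Rightarrow> 'k::field) set)"
    and "fun_space.dim (ker_WB (rect_graph m n) :: (point \<Rightarrow> 'k) set) = card I"
proof -
  let ?V = "ker_WB (rect_graph m n) :: (point \<Rightarrow> 'k) set"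
  have a: "finite I" by (simp add: I_def)
  have b: "fun_space.subspace ?V"
    unfolding ker_WB_eq by (rule subspace_adj_kernel)
  have c: "kernel_vector m n s \<in> ?V" if "s \<in> I" for s
    using that by (auto simp: ker_WB_eq I_def kernel_vector_in_kernel kernel_vector_parity)
  have d: "kernel_vector m n s (int t, 0) = (if t = s then 1 else 0 :: 'k)"
    if "s \<in> I" "t \<in> I" for s t
    using that by (intro kernel_vector_row) (auto simp: I_def)
  have e: "v = 0" if v: "v \<in> ?V" and row: "\<And>s. s \<in> I \<Longrightarrow> v (int s, 0) = 0" for v
  proof (rule adj_kernel_determined)
    show "v (int s, 0) = 0" if "s < gcd (m + 1) (n + 1) - 1" for s
      using v row[of s] that by (cases "even s") (auto simp: I_def ker_WB_eq)
  qed (use v in \<open>simp add: ker_WB_eq\<close>)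
  show "is_basis (kernel_vector m n ` I) ?V" "fun_space.dim ?V = card I"
    by (rule dual_family_basis[where q = "\<lambda>s. (int s, 0)"]; fact a b c d e)+
qed

section \<open>Counting the basis vectors\<close>

lemma card_even_odd_less:
  "2 * card {s. s < c \<and> even s} = c + c mod 2" "2 * card {s. s < c \<and> odd s} = c - c mod 2"
proof (induction c)
  case (Suc c)
  have "card {s. s < Suc c \<and> P s} = card {s. s < c \<and> P s} + (if P c then 1 else 0)" for P
  proof -
    have "{s. s < Suc c \<and> P s} = (if P c then insert c {s. s < c \<and> P s} else {s. s < c \<and> P s})"
      by (auto simp: less_Suc_eq)
    then show ?thesis by simp
  qed
  note eq = this[of even] this[of odd]
  {
    case 1
    show ?case using Suc unfolding eq by (simp add: mod2_eq_if)
  next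
    case 2
    show ?case using Suc unfolding eq by (simp add: mod2_eq_if odd_pos Suc_diff_Suc)
  }
qed simp_all

text \<open>Only the gcd enters, so this yields the dimensions for the \<open>c\<close> by
  \<open>c\<close> square, their equality with those of the rectangle, and independence of the
  field.\<close>

lemma dim_ker_rect_graph:
  assumes "c = gcd (m + 1) (n + 1) - 1"
  shows "2 * fun_space.dim (ker_BW (rect_graph m n) :: (point \<Rightarrow> 'k::field) set) = c + c mod 2"
    and "2 * fun_space.dim (ker_WB (rect_graph m n) :: (point \<Rightarrow> 'k) set) = c - c mod 2"
  unfolding ker_BW_basis(2) ker_WB_basis(2) assms by (rule card_even_odd_less)+

section \<open>The grid and the fundamental squares\<close>

text \<open>The grid lines are zero lines of a wave whose profile has period
  \<open>2 * (int c + 1)\<close>. Points of these lines outside the rectangle are included because a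
  neighbour of a fundamental square may lie there.\<close>

lemma adj_kernel_grid:
  fixes v :: "point \<Rightarrow> 'k::field"
  assumes v: "v \<in> adj_kernel (rect_graph m n)" and c: "int c + 1 = int (gcd (m + 1) (n + 1))"
    and line: "x \<in> grid_lines c \<or> y \<in> grid_lines c"
  shows "v (x, y) = 0"
proof (cases "(x, y) \<in> rect_graph m n")
  case True
  obtain F where F: "even_periodic (int c + 1) F"
    and rep: "\<And>x y. - 1 \<le> x \<Longrightarrow> x \<le> int m \<Longrightarrow> - 1 \<le> y \<Longrightarrow> y \<le> int n \<Longrightarrow> v (x, y) = wave F x y"
    using kernel_wave[OF v] unfolding c by metis
  have "wave F x y = 0"
    using line wave_column_eq_0[OF F] wave_row_eq_0[OF F] by (auto simp: grid_lines_def)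
  then show ?thesis using rep[of x y] True by (simp add: rect_graph_def)
qed (use v in \<open>simp add: adj_kernel_def\<close>)

text \<open>Since \<open>int c + 1\<close> divides both side lengths plus one, the bounds on the
  indices are integers, and k < a sharpens to k + 1 \<le> a. Hence the whole square fits.\<close>

lemma square_indices_bounds:
  assumes c: "int c + 1 = int (gcd (m + 1) (n + 1))" and kl: "(k, l) \<in> square_indices m n c"
  shows "0 \<le> k" "(k + 1) * (int c + 1) \<le> int m + 1" "0 \<le> l" "(l + 1) * (int c + 1) \<le> int n + 1"
proof -
  have *: "(k + 1) * (int c + 1) \<le> int p + 1"
    if k: "real_of_int k < (real p + 1) / (real c + 1)" and p: "int c + 1 dvd int p + 1" for k p
  proof -
    obtain a where a: "int p + 1 = (int c + 1) * a" using p by (auto elim: dvdE)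
    have "real_of_int k * (real c + 1) < real p + 1"
      using k by (simp add: pos_less_divide_eq)
    then have "real_of_int (k * (int c + 1)) < real_of_int (int p + 1)" by simp
    then have "k * (int c + 1) < a * (int c + 1)"
      unfolding of_int_less_iff a by (simp add: mult.commute)
    then have "k + 1 \<le> a" by (simp add: mult_less_cancel_right)
    then have "(k + 1) * (int c + 1) \<le> a * (int c + 1)" by (intro mult_right_mono) auto
    then show ?thesis unfolding a by (simp add: mult.commute)
  qed
  have "int c + 1 dvd int (m + 1)" "int c + 1 dvd int (n + 1)"
    unfolding c by (simp_all only: int_dvd_int_iff gcd_dvd1 gcd_dvd2)
  then have "int c + 1 dvd int m + 1" "int c + 1 dvd int n + 1"
    by (simp_all only: of_nat_add of_nat_1)
  with * kl show "0 \<le> k" "(k + 1) * (int c + 1) \<le> int m + 1" "0 \<le> l" "(l + 1) * (int c + 1) \<le> int n + 1"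
    by (auto simp: square_indices_def)
qed

lemma square_subset_rect_graph:
  assumes "int c + 1 = int (gcd (m + 1) (n + 1))" and "(k, l) \<in> square_indices m n c"
  shows "square c k l \<subseteq> rect_graph m n"
proof -
  note b = square_indices_bounds[OF assms]
  define u w where "u = k * (int c + 1)" and "w = l * (int c + 1)"
  have "0 \<le> u" "0 \<le> w" "u + int c \<le> int m" "w + int c \<le> int n"
    using b by (simp_all add: u_def w_def distrib_right)
  then show ?thesis
    by (auto simp: square_def rect_graph_def simp flip: u_def w_def)
qed

lemma square_boundary:
  assumes "(x, y) \<in> square c k l" "adjacent (x', y') (x, y)" "(x', y') \<notin> square c k l"
  shows "x' \<in> grid_lines c \<or> y' \<in> grid_lines c"
proof -
  have "x' = k * (int c + 1) - 1 \<or> x' = (k + 1) * (int c + 1) - 1 \<or>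
      y' = l * (int c + 1) - 1 \<or> y' = (l + 1) * (int c + 1) - 1"
    using assms by (auto simp: square_def adjacent_def algebra_simps)
  then show ?thesis unfolding grid_lines_def by blast
qed

text \<open>A neighbour outside the square lies on a bounding grid line, where \<open>v\<close> is
  zero, so dropping it does not change the neighbour sum.\<close>

lemma adj_kernel_square:
  fixes v :: "point \<Rightarrow> 'k::field"
  assumes v: "v \<in> adj_kernel (rect_graph m n)" and c: "int c + 1 = int (gcd (m + 1) (n + 1))"
    and S: "S \<in> fundamental_squares m n c"
  shows "restrict_to S v \<in> adj_kernel S"
    and "(x, y) \<in> S \<Longrightarrow> (\<Sum>b | b \<in> S \<and> adjacent b (x, y). v b) = 0"
proof -
  obtain k l where kl: "(k, l) \<in> square_indices m n c" and S: "S = square c k l"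
    using S by (auto simp: fundamental_squares_def)
  have boundary: "v b = 0" if "(x, y) \<in> S" "adjacent b (x, y)" "b \<notin> S" for b x y
    using that adj_kernel_grid[OF v c] square_boundary[of x y c k l "fst b" "snd b"]
    unfolding S by (cases b) auto
  have nb: "nbsum v x y = 0" if "(x, y) \<in> S" for x y
    using that v square_subset_rect_graph[OF c kl] unfolding S adj_kernel_def by auto
  show "(\<Sum>b | b \<in> S \<and> adjacent b (x, y). v b) = 0" if "(x, y) \<in> S"
    using sum_adjacent_eq_nbsum[of x y S v] boundary[OF that] nb[OF that] by simp
  have "nbsum (restrict_to S v) x y = nbsum v x y" if "(x, y) \<in> S" for x y
  proof -
    have "restrict_to S v b = v b" if "adjacent b (x, y)" for b
      using that boundary[OF \<open>(x, y) \<in> S\<close>, of b] by (simp add: restrict_to_def)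
    then show ?thesis by (simp add: nbsum_def adjacent_def)
  qed
  then show "restrict_to S v \<in> adj_kernel S"
    using nb by (auto simp: adj_kernel_def) (simp add: restrict_to_def)
qed

lemma adj_kernel_column_reflect:
  fixes v :: "point \<Rightarrow> 'k::field"
  assumes v: "v \<in> adj_kernel (rect_graph m n)" and c: "int c + 1 = int (gcd (m + 1) (n + 1))"
    and sep: "separated_by_column m n c x\<^sub>0 S\<^sub>1 S\<^sub>2"
  shows "S\<^sub>2 = (\<lambda>(x, y). (2 * x\<^sub>0 - x, y)) ` S\<^sub>1"
    and "(x, y) \<in> S\<^sub>1 \<Longrightarrow> v (2 * x\<^sub>0 - x, y) = - v (x, y)"
proof -
  obtain k l where kl: "(k, l) \<in> square_indices m n c" "(k + 1, l) \<in> square_indices m n c"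
    and x0: "x\<^sub>0 = (k + 1) * (int c + 1) - 1"
    and S: "S\<^sub>1 = square c k l \<and> S\<^sub>2 = square c (k + 1) l \<or>
         S\<^sub>1 = square c (k + 1) l \<and> S\<^sub>2 = square c k l"
    using sep unfolding separated_by_column_def by blast
  \<comment> \<open>The reflection is an involution, so one equivalence serves both orders of the
    two squares.\<close>
  have mem: "(2 * x\<^sub>0 - x, y) \<in> S\<^sub>1 \<longleftrightarrow> (x, y) \<in> S\<^sub>2" for x y
    using S unfolding x0 by (auto simp: square_def algebra_simps)
  show "S\<^sub>2 = (\<lambda>(x, y). (2 * x\<^sub>0 - x, y)) ` S\<^sub>1"
  proof (intro set_eqI iffI)
    fix p assume "p \<in> S\<^sub>2"
    then show "p \<in> (\<lambda>(x, y). (2 * x\<^sub>0 - x, y)) ` S\<^sub>1"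
      using mem[of "fst p" "snd p"] by (intro image_eqI[of _ _ "(2 * x\<^sub>0 - fst p, snd p)"]) auto
  next
    fix p assume "p \<in> (\<lambda>(x, y). (2 * x\<^sub>0 - x, y)) ` S\<^sub>1"
    then obtain x y where "(x, y) \<in> S\<^sub>1" "p = (2 * x\<^sub>0 - x, y)" by auto
    then show "p \<in> S\<^sub>2" using mem[of "2 * x\<^sub>0 - x" y] by simp
  qed
  obtain F where F: "even_periodic (int c + 1) F"
    and rep: "\<And>x y. - 1 \<le> x \<Longrightarrow> x \<le> int m \<Longrightarrow> - 1 \<le> y \<Longrightarrow> y \<le> int n \<Longrightarrow> v (x, y) = wave F x y"
    using kernel_wave[OF v] unfolding c by metis
  have "S\<^sub>1 \<subseteq> rect_graph m n" "S\<^sub>2 \<subseteq> rect_graph m n"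
    using S square_subset_rect_graph[OF c kl(1)] square_subset_rect_graph[OF c kl(2)] by auto
  then have rep': "v (x, y) = wave F x y" if "(x, y) \<in> S\<^sub>1 \<union> S\<^sub>2" for x y
    using that by (intro rep) (auto simp: rect_graph_def)
  show "v (2 * x\<^sub>0 - x, y) = - v (x, y)" if "(x, y) \<in> S\<^sub>1"
    using that mem[of "2 * x\<^sub>0 - x" y] rep'[of x y] rep'[of "2 * x\<^sub>0 - x" y]
      wave_column_reflect[OF F, of "k + 1" x y] by (simp add: x0)
qed

lemma adj_kernel_row_reflect:
  fixes v :: "point \<Rightarrow> 'k::field"
  assumes v: "v \<in> adj_kernel (rect_graph m n)" and c: "int c + 1 = int (gcd (m + 1) (n + 1))"
    and sep: "separated_by_row m n c y\<^sub>0 S\<^sub>1 S\<^sub>2"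
  shows "S\<^sub>2 = (\<lambda>(x, y). (x, 2 * y\<^sub>0 - y)) ` S\<^sub>1"
    and "(x, y) \<in> S\<^sub>1 \<Longrightarrow> v (x, 2 * y\<^sub>0 - y) = - v (x, y)"
proof -
  obtain k l where kl: "(k, l) \<in> square_indices m n c" "(k, l + 1) \<in> square_indices m n c"
    and y0: "y\<^sub>0 = (l + 1) * (int c + 1) - 1"
    and S: "S\<^sub>1 = square c k l \<and> S\<^sub>2 = square c k (l + 1) \<or>
         S\<^sub>1 = square c k (l + 1) \<and> S\<^sub>2 = square c k l"
    using sep unfolding separated_by_row_def by blast
  have mem: "(x, 2 * y\<^sub>0 - y) \<in> S\<^sub>1 \<longleftrightarrow> (x, y) \<in> S\<^sub>2" for x y
    using S unfolding y0 by (auto simp: square_def algebra_simps)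
  show "S\<^sub>2 = (\<lambda>(x, y). (x, 2 * y\<^sub>0 - y)) ` S\<^sub>1"
  proof (intro set_eqI iffI)
    fix p assume "p \<in> S\<^sub>2"
    then show "p \<in> (\<lambda>(x, y). (x, 2 * y\<^sub>0 - y)) ` S\<^sub>1"
      using mem[of "fst p" "snd p"] by (intro image_eqI[of _ _ "(fst p, 2 * y\<^sub>0 - snd p)"]) auto
  next
    fix p assume "p \<in> (\<lambda>(x, y). (x, 2 * y\<^sub>0 - y)) ` S\<^sub>1"
    then obtain x y where "(x, y) \<in> S\<^sub>1" "p = (x, 2 * y\<^sub>0 - y)" by auto
    then show "p \<in> S\<^sub>2" using mem[of x "2 * y\<^sub>0 - y"] by simp
  qed
  obtain F where F: "even_periodic (int c + 1) F"
    and rep: "\<And>x y. - 1 \<le> x \<Longrightarrow> x \<le> int m \<Longrightarrow> - 1 \<le> y \<Longrightarrow> y \<le> int n \<Longrightarrow> v (x, y) = wave F x y"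
    using kernel_wave[OF v] unfolding c by metis
  have "S\<^sub>1 \<subseteq> rect_graph m n" "S\<^sub>2 \<subseteq> rect_graph m n"
    using S square_subset_rect_graph[OF c kl(1)] square_subset_rect_graph[OF c kl(2)] by auto
  then have rep': "v (x, y) = wave F x y" if "(x, y) \<in> S\<^sub>1 \<union> S\<^sub>2" for x y
    using that by (intro rep) (auto simp: rect_graph_def)
  show "v (x, 2 * y\<^sub>0 - y) = - v (x, y)" if "(x, y) \<in> S\<^sub>1"
    using that mem[of x "2 * y\<^sub>0 - y"] rep'[of x y] rep'[of x "2 * y\<^sub>0 - y"]
      wave_row_reflect[OF F, of x "l + 1" y] by (simp add: y0)
qed

theorem theorem3:
  fixes m n c :: nat
  assumes "m > 0" and "n > 0" and "c = gcd (m + 1) (n + 1) - 1"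
  shows
    \<comment> \<open>(i)\<close>
    "(\<forall>v \<in> (ker_BW (rect_graph m n) \<union> ker_WB (rect_graph m n) :: (point \<Rightarrow> 'k::field) set).
        \<forall>p \<in> grid m n c. v p = 0) \<and>
    \<comment> \<open>(ii)\<close>
     (\<forall>v \<in> (ker_BW (rect_graph m n) :: (point \<Rightarrow> 'k) set). \<forall>S \<in> fundamental_squares m n c.
        restrict_to S v \<in> ker_BW S \<and>
        (\<forall>p \<in> white_points S. (\<Sum>b | b \<in> S \<and> adjacent b p. v b) = 0)) \<and>
     (\<forall>v \<in> (ker_WB (rect_graph m n) :: (point \<Rightarrow> 'k) set). \<forall>S \<in> fundamental_squares m n c.
        restrict_to S v \<in> ker_WB S \<and>
        (\<forall>p \<in> black_points S. (\<Sum>b | b \<in> S \<and> adjacent b p. v b) = 0)) \<and>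
    \<comment> \<open>(iii)\<close>
     (\<forall>v \<in> (ker_BW (rect_graph m n) \<union> ker_WB (rect_graph m n) :: (point \<Rightarrow> 'k) set).
        (\<forall>x\<^sub>0 S\<^sub>1 S\<^sub>2. separated_by_column m n c x\<^sub>0 S\<^sub>1 S\<^sub>2 \<longrightarrow>
           S\<^sub>2 = (\<lambda>(x, y). (2 * x\<^sub>0 - x, y)) ` S\<^sub>1 \<and>
           (\<forall>(x, y) \<in> S\<^sub>1. v (2 * x\<^sub>0 - x, y) = - v (x, y))) \<and>
        (\<forall>y\<^sub>0 S\<^sub>1 S\<^sub>2. separated_by_row m n c y\<^sub>0 S\<^sub>1 S\<^sub>2 \<longrightarrow>
           S\<^sub>2 = (\<lambda>(x, y). (x, 2 * y\<^sub>0 - y)) ` S\<^sub>1 \<and>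
           (\<forall>(x, y) \<in> S\<^sub>1. v (x, 2 * y\<^sub>0 - y) = - v (x, y)))) \<and>
    \<comment> \<open>(iv)\<close>
     2 * fun_space.dim (ker_BW (rect_graph c c) :: (point \<Rightarrow> 'k) set) = c + c mod 2 \<and>
     2 * fun_space.dim (ker_WB (rect_graph c c) :: (point \<Rightarrow> 'k) set) = c - c mod 2 \<and>
    \<comment> \<open>(v)\<close>
     fun_space.dim (ker_BW (rect_graph m n) :: (point \<Rightarrow> 'k) set) =
       fun_space.dim (ker_BW (rect_graph c c) :: (point \<Rightarrow> 'k) set) \<and>
     fun_space.dim (ker_WB (rect_graph m n) :: (point \<Rightarrow> 'k) set) =
       fun_space.dim (ker_WB (rect_graph c c) :: (point \<Rightarrow> 'k) set) \<and>
    \<comment> \<open>(vi)\<close>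
     (\<exists>B. is_basis B (ker_BW (rect_graph m n) :: (point \<Rightarrow> 'k) set) \<and>
        (\<forall>b \<in> B. \<forall>p. b p \<in> {0, 1, - 1})) \<and>
     (\<exists>B. is_basis B (ker_WB (rect_graph m n) :: (point \<Rightarrow> 'k) set) \<and>
        (\<forall>b \<in> B. \<forall>p. b p \<in> {0, 1, - 1})) \<and>
    \<comment> \<open>independence of the field\<close>
     fun_space.dim (ker_BW (rect_graph m n) :: (point \<Rightarrow> 'k) set) =
       fun_space.dim (ker_BW (rect_graph m n) :: (point \<Rightarrow> 'l::field) set) \<and>
     fun_space.dim (ker_WB (rect_graph m n) :: (point \<Rightarrow> 'k) set) =
       fun_space.dim (ker_WB (rect_graph m n) :: (point \<Rightarrow> 'l) set)"
proof (intro conjI)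
  \<comment> \<open>The gcd is positive, so the truncated subtraction in the definition of
    \<open>c\<close> loses nothing.\<close>
  have c: "int c + 1 = int (gcd (m + 1) (n + 1))"
    using assms(3) by (simp add: of_nat_diff Suc_le_eq)
  have ker: "v \<in> adj_kernel S" if "v \<in> ker_BW S \<union> ker_WB S" for v :: "point \<Rightarrow> 'k" and S
    using that by (auto simp: ker_BW_eq ker_WB_eq)
  show "\<forall>v \<in> ker_BW (rect_graph m n) \<union> ker_WB (rect_graph m n) :: (point \<Rightarrow> 'k) set.
      \<forall>p \<in> grid m n c. v p = 0"
    using adj_kernel_grid[OF ker c] by (auto simp: grid_def)
  show "\<forall>v \<in> ker_BW (rect_graph m n) :: (point \<Rightarrow> 'k) set. \<forall>S \<in> fundamental_squares m n c.
        restrict_to S v \<in> ker_BW S \<and>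
        (\<forall>p \<in> white_points S. (\<Sum>b | b \<in> S \<and> adjacent b p. v b) = 0)"
  proof (intro ballI conjI)
    fix v :: "point \<Rightarrow> 'k" and S
    assume v: "v \<in> ker_BW (rect_graph m n)" and S: "S \<in> fundamental_squares m n c"
    note sq = adj_kernel_square[OF ker c S, of v]
    show "restrict_to S v \<in> ker_BW S"
      using v sq(1) unfolding ker_BW_eq by (auto simp: restrict_to_def)
    show "(\<Sum>b | b \<in> S \<and> adjacent b p. v b) = 0" if "p \<in> white_points S" for p
      using v sq(2) that by (auto simp: white_points_def)
  qed
  show "\<forall>v \<in> ker_WB (rect_graph m n) :: (point \<Rightarrow> 'k) set. \<forall>S \<in> fundamental_squares m n c.
        restrict_to S v \<in> ker_WB S \<and>
        (\<forall>p \<in> black_points S. (\<Sum>b | b \<in> S \<and> adjacent b p. v b) = 0)"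
  proof (intro ballI conjI)
    fix v :: "point \<Rightarrow> 'k" and S
    assume v: "v \<in> ker_WB (rect_graph m n)" and S: "S \<in> fundamental_squares m n c"
    note sq = adj_kernel_square[OF ker c S, of v]
    show "restrict_to S v \<in> ker_WB S"
      using v sq(1) unfolding ker_WB_eq by (auto simp: restrict_to_def)
    show "(\<Sum>b | b \<in> S \<and> adjacent b p. v b) = 0" if "p \<in> black_points S" for p
      using v sq(2) that by (auto simp: black_points_def)
  qed
  show "\<forall>v \<in> ker_BW (rect_graph m n) \<union> ker_WB (rect_graph m n) :: (point \<Rightarrow> 'k) set.
        (\<forall>x\<^sub>0 S\<^sub>1 S\<^sub>2. separated_by_column m n c x\<^sub>0 S\<^sub>1 S\<^sub>2 \<longrightarrow>
           S\<^sub>2 = (\<lambda>(x, y). (2 * x\<^sub>0 - x, y)) ` S\<^sub>1 \<and>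
           (\<forall>(x, y) \<in> S\<^sub>1. v (2 * x\<^sub>0 - x, y) = - v (x, y))) \<and>
        (\<forall>y\<^sub>0 S\<^sub>1 S\<^sub>2. separated_by_row m n c y\<^sub>0 S\<^sub>1 S\<^sub>2 \<longrightarrow>
           S\<^sub>2 = (\<lambda>(x, y). (x, 2 * y\<^sub>0 - y)) ` S\<^sub>1 \<and>
           (\<forall>(x, y) \<in> S\<^sub>1. v (x, 2 * y\<^sub>0 - y) = - v (x, y)))"
  proof (intro ballI conjI allI impI)
    fix v :: "point \<Rightarrow> 'k" and z S\<^sub>1 S\<^sub>2
    assume v: "v \<in> ker_BW (rect_graph m n) \<union> ker_WB (rect_graph m n)"
    {
      assume sep: "separated_by_column m n c z S\<^sub>1 S\<^sub>2"
      note r = adj_kernel_column_reflect[OF ker[OF v] c sep]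
      show "S\<^sub>2 = (\<lambda>(x, y). (2 * z - x, y)) ` S\<^sub>1" by (rule r(1))
      show "case p of (x, y) \<Rightarrow> v (2 * z - x, y) = - v (x, y)" if "p \<in> S\<^sub>1" for p
        using that r(2) by (cases p) simp
    next
      assume sep: "separated_by_row m n c z S\<^sub>1 S\<^sub>2"
      note r = adj_kernel_row_reflect[OF ker[OF v] c sep]
      show "S\<^sub>2 = (\<lambda>(x, y). (x, 2 * z - y)) ` S\<^sub>1" by (rule r(1))
      show "case p of (x, y) \<Rightarrow> v (x, 2 * z - y) = - v (x, y)" if "p \<in> S\<^sub>1" for p
        using that r(2) by (cases p) simp
    }
  qed
  \<comment> \<open>The square is itself the rectangle with both sides \<open>c\<close>, and the
    general dimension formula returns the same \<open>c\<close>.\<close>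
  have "c = gcd (c + 1) (c + 1) - 1"
    by simp
  note square_dims = dim_ker_rect_graph[OF this]
  note rect_dims = dim_ker_rect_graph[OF assms(3)]
  show "2 * fun_space.dim (ker_BW (rect_graph c c) :: (point \<Rightarrow> 'k) set) = c + c mod 2"
    by (rule square_dims)
  show "2 * fun_space.dim (ker_WB (rect_graph c c) :: (point \<Rightarrow> 'k) set) = c - c mod 2"
    by (rule square_dims)
  show "fun_space.dim (ker_BW (rect_graph m n) :: (point \<Rightarrow> 'k) set) =
      fun_space.dim (ker_BW (rect_graph c c) :: (point \<Rightarrow> 'k) set)"
    using rect_dims(1)[where 'k = 'k] square_dims(1)[where 'k = 'k] by linarith
  show "fun_space.dim (ker_WB (rect_graph m n) :: (point \<Rightarrow> 'k) set) =
      fun_space.dim (ker_WB (rect_graph c c) :: (point \<Rightarrow> 'k) set)"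
    using rect_dims(2)[where 'k = 'k] square_dims(2)[where 'k = 'k] by linarith
  show "\<exists>B. is_basis B (ker_BW (rect_graph m n) :: (point \<Rightarrow> 'k) set) \<and>
      (\<forall>b \<in> B. \<forall>p. b p \<in> {0, 1, - 1})"
    using ker_BW_basis(1)[of m n, where 'k = 'k] kernel_vector_values[of m n, where 'a = 'k]
    by blast
  show "\<exists>B. is_basis B (ker_WB (rect_graph m n) :: (point \<Rightarrow> 'k) set) \<and>
      (\<forall>b \<in> B. \<forall>p. b p \<in> {0, 1, - 1})"
    using ker_WB_basis(1)[of m n, where 'k = 'k] kernel_vector_values[of m n, where 'a = 'k]
    by blast
  show "fun_space.dim (ker_BW (rect_graph m n) :: (point \<Rightarrow> 'k) set) =
      fun_space.dim (ker_BW (rect_graph m n) :: (point \<Rightarrow> 'l) set)"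
    using rect_dims(1)[where 'k = 'k] rect_dims(1)[where 'k = 'l] by linarith
  show "fun_space.dim (ker_WB (rect_graph m n) :: (point \<Rightarrow> 'k) set) =
      fun_space.dim (ker_WB (rect_graph m n) :: (point \<Rightarrow> 'l) set)"
    using rect_dims(2)[where 'k = 'k] rect_dims(2)[where 'k = 'l] by linarith
qed

end
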